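(* Let $A\in\mathfrak p$ be a regular element. The spectral invariants of $L_\lambda=L_{\mathfrak p}-\lambda L_{\mathfrak k}+(\lambda^2-1)A$ Poisson commute with each other relative to the semisimple Lie algebra structure on $\mathfrak g$, while the spectral invariants of $L_\lambda=L_{\mathfrak p}-\lambda L_{\mathfrak k}+\lambda^2A$ Poisson commute with each other relative to the semidirect product structure on $\mathfrak g$.
   Context: $G$ is a connected semisimple Lie group with Lie algebra $\mathfrak g$; $\sigma\neq I$ is an involutive automorphism of $G$ with compact fixed point group $K$, and $(G,K)$ is a Riemannian symmetric pair; $\mathfrak g=\mathfrak p\oplus\mathfrak k$ is the splitting into the $-1$ eigenspace $\mathfrak p$ and $+1$ eigenspace $\mathfrak k$ of $\sigma_*$, with $[\mathfrak p,\mathfrak p]=\mathfrak k$, $[\mathfrak p,\mathfrak k]=\mathfrak p$, $[\mathfrak k,\mathfrak k]\subseteq\mathfrak k$. $A\in\mathfrak p$ is regular if $\{B\in\mathfrak p:[A,B]=0\}$ is abelian. $\langle\ ,\ \rangle$ is a nonzero scalar multiple of the Killing form of $\mathfrak g$ and is used to identify $\mathfrak g^*$ with $\mathfrak g$; write $L=L_{\mathfrak p}+L_{\mathfrak k}$ with $L_{\mathfrak p}\in\mathfrak p$, $L_{\mathfrak k}\in\mathfrak k$. Two Poisson brackets on functions on $\mathfrak g$: $\{f,h\}(L)=\langle L,[df(L),dh(L)]\rangle$ (semisimple structure) and $\{f,h\}_s(L)=\langle L,[df(L),dh(L)]_s\rangle$ (semidirect structure), where differentials are viewed in $\mathfrak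 g$ via $\langle\ ,\ \rangle$ and, for $A_i\in\mathfrak p$, $B_i\in\mathfrak k$, $[A_1+B_1,A_2+B_2]_s=[B_1,A_2]-[B_2,A_1]+[B_1,B_2]$ is the bracket of the Lie algebra of the semidirect product $\mathfrak p\rtimes K$. Spectral invariants of $L_\lambda$: the functions $L\mapsto f(L_\lambda)$, where $f$ is a coefficient of the characteristic polynomial (of $L_\lambda$ as a matrix in a matrix realization of $\mathfrak g$, or of $ad\,L_\lambda$) and $\lambda$ is any value of the parameter; "Poisson commute with each other" means that the bracket of any two such functions, possibly for two different values of $\lambda$, vanishes. *)

theory Defs
  imports
    "HOL-Analysis.Analysis"
    "HOL-Algebra.Group"
    "Jordan_Normal_Form.Char_Poly"
begin

section \<open>Smooth manifolds and Lie groups\<close>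

text \<open>Meant for open sets, where the unrestricted \<open>at x\<close> sees only values of \<open>f\<close> on the set.\<close>

primrec Ck_on :: "nat \<Rightarrow> 'a::real_normed_vector set \<Rightarrow> ('a \<Rightarrow> 'b::real_normed_vector) \<Rightarrow> bool" where
  "Ck_on 0 S f \<longleftrightarrow> continuous_on S f"
| "Ck_on (Suc k) S f \<longleftrightarrow>
     (\<forall>x\<in>S. f differentiable (at x)) \<and> (\<forall>v. Ck_on k S (\<lambda>x. frechet_derivative f (at x) v))"

definition smooth_on :: "'a::real_normed_vector set \<Rightarrow> ('a \<Rightarrow> 'b::real_normed_vector) \<Rightarrow> bool" where
  "smooth_on S f \<longleftrightarrow> (\<forall>k. Ck_on k S f)"

type_synonym ('g, 'v) chart = "'g set \<times> ('g \<Rightarrow> 'v)"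

definition is_chart :: "'g topology \<Rightarrow> 'g set \<Rightarrow> ('g \<Rightarrow> 'v::euclidean_space) \<Rightarrow> bool" where
  "is_chart T U \<phi> \<longleftrightarrow>
     openin T U \<and> open (\<phi> ` U) \<and>
     homeomorphic_map (subtopology T U) (top_of_set (\<phi> ` U)) \<phi>"

definition smooth_manifold :: "'g topology \<Rightarrow> ('g, 'v::euclidean_space) chart set \<Rightarrow> bool" where
  "smooth_manifold T \<A> \<longleftrightarrow>
     Hausdorff_space T \<and> second_countable T \<and>
     (\<forall>(U, \<phi>) \<in> \<A>. is_chart T U \<phi>) \<and>
     \<Union> (fst ` \<A>) = topspace T \<and>
     (\<forall>(U, \<phi>) \<in> \<A>. \<forall>(V, \<psi>) \<in> \<A>. smooth_on (\<phi> ` (U \<inter> V)) (\<psi> \<circ> inv_into U \<phi>))"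

definition smooth_map ::
    "'g topology \<Rightarrow> ('g, 'v::euclidean_space) chart set \<Rightarrow>
     'h topology \<Rightarrow> ('h, 'w::euclidean_space) chart set \<Rightarrow> ('g \<Rightarrow> 'h) \<Rightarrow> bool" where
  "smooth_map T \<A> T' \<A>' f \<longleftrightarrow>
     continuous_map T T' f \<and>
     (\<forall>(U, \<phi>) \<in> \<A>. \<forall>(V, \<psi>) \<in> \<A>'. smooth_on (\<phi> ` {x \<in> U. f x \<in> V}) (\<psi> \<circ> f \<circ> inv_into U \<phi>))"

definition prod_atlas ::
    "('g, 'v) chart set \<Rightarrow> ('h, 'w) chart set \<Rightarrow> ('g \<times> 'h, 'v \<times> 'w) chart set" where
  "prod_atlas \<A> \<B> = {(U \<times> V, map_prod \<phi> \<psi>) | U \<phi> V \<psi>. (U, \<phi>) \<in> \<A> \<and> (V, \<psi>) \<in> \<B>}"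

definition lie_group ::
    "('g, 'r) monoid_scheme \<Rightarrow> 'g topology \<Rightarrow> ('g, 'v::euclidean_space) chart set \<Rightarrow> bool" where
  "lie_group G T \<A> \<longleftrightarrow>
     group G \<and> topspace T = carrier G \<and> smooth_manifold T \<A> \<and>
     smooth_map (prod_topology T T) (prod_atlas \<A> \<A>) T \<A> (\<lambda>(x, y). x \<otimes>\<^bsub>G\<^esub> y) \<and>
     smooth_map T \<A> T \<A> (\<lambda>x. inv\<^bsub>G\<^esub> x)"

text \<open>
  A chart \<open>\<phi>\<close> around the identity identifies the tangent space at the identity with the model
  space \<open>'v\<close>.  \<open>left_field\<close> is the left-invariant vector field with value \<open>X\<close> at the identity, and
  \<open>lie_bracket_at\<close> is the value at the identity of the bracket \<open>DY X - DX Y\<close> of two such fields,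
  both computed in the coordinates \<open>\<phi>\<close>.
\<close>

definition left_field ::
    "('g, 'r) monoid_scheme \<Rightarrow> 'g set \<Rightarrow> ('g \<Rightarrow> 'v::euclidean_space) \<Rightarrow> 'v \<Rightarrow> 'v \<Rightarrow> 'v" where
  "left_field G U \<phi> X x =
     frechet_derivative (\<lambda>y. \<phi> (inv_into U \<phi> x \<otimes>\<^bsub>G\<^esub> inv_into U \<phi> y)) (at (\<phi> \<one>\<^bsub>G\<^esub>)) X"

definition lie_bracket_at ::
    "('g, 'r) monoid_scheme \<Rightarrow> 'g set \<Rightarrow> ('g \<Rightarrow> 'v::euclidean_space) \<Rightarrow> 'v \<Rightarrow> 'v \<Rightarrow> 'v" where
  "lie_bracket_at G U \<phi> X Y =
     frechet_derivative (left_field G U \<phi> Y) (at (\<phi> \<one>\<^bsub>G\<^esub>)) X -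
     frechet_derivative (left_field G U \<phi> X) (at (\<phi> \<one>\<^bsub>G\<^esub>)) Y"

text \<open>The tangent map at the identity of a map that fixes the identity.\<close>

definition tangent_map ::
    "('g, 'r) monoid_scheme \<Rightarrow> 'g set \<Rightarrow> ('g \<Rightarrow> 'v::euclidean_space) \<Rightarrow> ('g \<Rightarrow> 'g) \<Rightarrow> 'v \<Rightarrow> 'v" where
  "tangent_map G U \<phi> f = frechet_derivative (\<phi> \<circ> f \<circ> inv_into U \<phi>) (at (\<phi> \<one>\<^bsub>G\<^esub>))"

definition involutive_automorphism ::
    "('g, 'r) monoid_scheme \<Rightarrow> 'g topology \<Rightarrow> ('g, 'v::euclidean_space) chart set \<Rightarrow>
     ('g \<Rightarrow> 'g) \<Rightarrow> bool" where
  "involutive_automorphism G T \<A> \<sigma> \<longleftrightarrow>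
     \<sigma> \<in> iso G G \<and> smooth_map T \<A> T \<A> \<sigma> \<and>
     (\<forall>x\<in>carrier G. \<sigma> (\<sigma> x) = x) \<and> (\<exists>x\<in>carrier G. \<sigma> x \<noteq> x)"

definition fixed_points :: "('g, 'r) monoid_scheme \<Rightarrow> ('g \<Rightarrow> 'g) \<Rightarrow> 'g set" where
  "fixed_points G \<sigma> = {x \<in> carrier G. \<sigma> x = x}"

text \<open>
  \<open>K\<close> is a closed subgroup lying between the fixed point group of \<open>\<sigma>\<close> and its identity component,
  and \<open>Ad(K)\<close> is a compact set of linear operators.
\<close>

definition riemannian_symmetric_pair ::
    "('g, 'r) monoid_scheme \<Rightarrow> 'g topology \<Rightarrow> 'g set \<Rightarrow> ('g \<Rightarrow> 'v::euclidean_space) \<Rightarrow>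
     ('g \<Rightarrow> 'g) \<Rightarrow> 'g set \<Rightarrow> bool" where
  "riemannian_symmetric_pair G T U \<phi> \<sigma> K \<longleftrightarrow>
     subgroup K G \<and> closedin T K \<and> K \<subseteq> fixed_points G \<sigma> \<and>
     connected_component_of_set (subtopology T (fixed_points G \<sigma>)) \<one>\<^bsub>G\<^esub> \<subseteq> K \<and>
     compact ((\<lambda>g. Blinfun (tangent_map G U \<phi> (\<lambda>x. g \<otimes>\<^bsub>G\<^esub> x \<otimes>\<^bsub>G\<^esub> inv\<^bsub>G\<^esub> g))) ` K)"

section \<open>Lie algebras\<close>

definition lie_algebra :: "('v::euclidean_space \<Rightarrow> 'v \<Rightarrow> 'v) \<Rightarrow> bool" where
  "lie_algebra br \<longleftrightarrow>
     bilinear br \<and> (\<forall>X. br X X = 0) \<and>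
     (\<forall>X Y Z. br X (br Y Z) + br Y (br Z X) + br Z (br X Y) = 0)"

text \<open>
  The matrix of a linear operator with respect to some enumeration of the standard basis; its
  characteristic polynomial does not depend on the enumeration.
\<close>

definition op_matrix :: "('v::euclidean_space \<Rightarrow> 'v) \<Rightarrow> real mat" where
  "op_matrix f =
     (let bs = (SOME bs. distinct bs \<and> set bs = (Basis :: 'v set))
      in mat DIM('v) DIM('v) (\<lambda>(i, j). inner (f (bs ! j)) (bs ! i)))"

definition op_trace :: "('v::euclidean_space \<Rightarrow> 'v) \<Rightarrow> real" where
  "op_trace f = (\<Sum>b\<in>Basis. inner (f b) b)"

definition killing_form :: "('v::euclidean_space \<Rightarrow> 'v \<Rightarrow> 'v) \<Rightarrow> 'v \<Rightarrow> 'v \<Rightarrow> real" where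
  "killing_form br X Y = op_trace (br X \<circ> br Y)"

definition semisimple :: "('v::euclidean_space \<Rightarrow> 'v \<Rightarrow> 'v) \<Rightarrow> bool" where
  "semisimple br \<longleftrightarrow> (\<forall>X. (\<forall>Y. killing_form br X Y = 0) \<longrightarrow> X = 0)"

definition eigen_p :: "('v::real_vector \<Rightarrow> 'v) \<Rightarrow> 'v set" where
  "eigen_p s = {X. s X = - X}"

definition eigen_k :: "('v::real_vector \<Rightarrow> 'v) \<Rightarrow> 'v set" where
  "eigen_k s = {X. s X = X}"

text \<open>The components of \<open>X\<close> in the two eigenspaces of a linear involution \<open>s\<close>.\<close>

definition part_p :: "('v::real_vector \<Rightarrow> 'v) \<Rightarrow> 'v \<Rightarrow> 'v" where
  "part_p s X = (1/2) *\<^sub>R (X - s X)"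

definition part_k :: "('v::real_vector \<Rightarrow> 'v) \<Rightarrow> 'v \<Rightarrow> 'v" where
  "part_k s X = (1/2) *\<^sub>R (X + s X)"

definition bracket_span :: "('v::real_vector \<Rightarrow> 'v \<Rightarrow> 'v) \<Rightarrow> 'v set \<Rightarrow> 'v set \<Rightarrow> 'v set" where
  "bracket_span br S S' = span {br X Y | X Y. X \<in> S \<and> Y \<in> S'}"

definition regular_element :: "('v::real_vector \<Rightarrow> 'v \<Rightarrow> 'v) \<Rightarrow> ('v \<Rightarrow> 'v) \<Rightarrow> 'v \<Rightarrow> bool" where
  "regular_element br s A \<longleftrightarrow>
     A \<in> eigen_p s \<and>
     (\<forall>X\<in>eigen_p s. \<forall>Y\<in>eigen_p s. br A X = 0 \<and> br A Y = 0 \<longrightarrow> br X Y = 0)"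

definition semidirect_bracket ::
    "('v::real_vector \<Rightarrow> 'v \<Rightarrow> 'v) \<Rightarrow> ('v \<Rightarrow> 'v) \<Rightarrow> 'v \<Rightarrow> 'v \<Rightarrow> 'v" where
  "semidirect_bracket br s X Y =
     br (part_k s X) (part_p s Y) - br (part_k s Y) (part_p s X) + br (part_k s X) (part_k s Y)"

section \<open>Poisson brackets and spectral invariants\<close>

text \<open>The differential of \<open>f\<close> at \<open>L\<close>, viewed as a vector by means of the form \<open>ip\<close>.\<close>

definition differential ::
    "('v \<Rightarrow> 'v \<Rightarrow> real) \<Rightarrow> ('v::euclidean_space \<Rightarrow> real) \<Rightarrow> 'v \<Rightarrow> 'v" where
  "differential ip f L = (THE X. \<forall>Y. ip X Y = frechet_derivative f (at L) Y)"

definition poisson ::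
    "('v \<Rightarrow> 'v \<Rightarrow> real) \<Rightarrow> ('v \<Rightarrow> 'v \<Rightarrow> 'v) \<Rightarrow>
     ('v::euclidean_space \<Rightarrow> real) \<Rightarrow> ('v \<Rightarrow> real) \<Rightarrow> 'v \<Rightarrow> real" where
  "poisson ip br f h L = ip L (br (differential ip f L) (differential ip h L))"

text \<open>
  A realization of the Lie algebra by \<open>n \<times> n\<close> matrices, i.e. an isomorphism onto a real Lie
  algebra of complex matrices.  A realization by real matrices is the special case in which all
  entries are real.
\<close>

definition matrix_realization ::
    "('v::euclidean_space \<Rightarrow> 'v \<Rightarrow> 'v) \<Rightarrow> nat \<Rightarrow> ('v \<Rightarrow> complex mat) \<Rightarrow> bool" where
  "matrix_realization br n \<rho> \<longleftrightarrow>
     (\<forall>X. \<rho> X \<in> carrier_mat n n) \<and>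
     (\<forall>X Y. \<rho> (X + Y) = \<rho> X + \<rho> Y) \<and>
     (\<forall>a X. \<rho> (a *\<^sub>R X) = complex_of_real a \<cdot>\<^sub>m \<rho> X) \<and>
     (\<forall>X Y. \<rho> (br X Y) = \<rho> X * \<rho> Y - \<rho> Y * \<rho> X) \<and>
     inj \<rho>"

text \<open>
  Poisson brackets are taken of real functions, so a complex coefficient of a characteristic
  polynomial contributes its real and imaginary parts.
\<close>

definition spectral_functions :: "('v::euclidean_space \<Rightarrow> 'v \<Rightarrow> 'v) \<Rightarrow> ('v \<Rightarrow> real) set" where
  "spectral_functions br =
     {\<lambda>X. coeff (char_poly (op_matrix (br X))) k | k. True} \<union>
     {\<lambda>X. Re (coeff (char_poly (\<rho> X)) k) | \<rho> n k. matrix_realization br n \<rho>} \<union>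
     {\<lambda>X. Im (coeff (char_poly (\<rho> X)) k) | \<rho> n k. matrix_realization br n \<rho>}"

text \<open>
  The functions \<open>L \<mapsto> f (L\<^sub>\<lambda>)\<close>, for all spectral functions \<open>f\<close> and all real values of the parameter
  \<open>\<lambda>\<close> of the family \<open>\<Lambda> \<lambda> L = L\<^sub>\<lambda>\<close>.
\<close>

definition spectral_invariants ::
    "('v::euclidean_space \<Rightarrow> 'v \<Rightarrow> 'v) \<Rightarrow> (real \<Rightarrow> 'v \<Rightarrow> 'v) \<Rightarrow> ('v \<Rightarrow> real) set" where
  "spectral_invariants br \<Lambda> = {\<lambda>L. f (\<Lambda> t L) | f t. f \<in> spectral_functions br}"

end

theory Submission
  imports Defs
begin

text \<open>
  If \<open>F\<close> is a spectral function, then its gradient at \<open>M\<close> with respect to the form commutes with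
  \<open>M\<close>.  Hence the gradient of \<open>L \<mapsto> F (L\<^sub>\<lambda>)\<close> is \<open>X\<^sub>\<p> - \<lambda> X\<^sub>\<k>\<close> with \<open>[L\<^sub>\<lambda>, X] = 0\<close>.  For two parameters with
  \<open>\<lambda>\<^sup>2 \<noteq> \<mu>\<^sup>2\<close>, invariance of the form turns the two commutation relations into linear equations between
  triple products \<open>\<langle>\<cdot>, [\<cdot>, \<cdot>]\<rangle>\<close>, from which the vanishing of the Poisson bracket follows by elimination;
  the case \<open>\<lambda>\<^sup>2 = \<mu>\<^sup>2\<close> follows by continuity.  Both Poisson structures are treated at once
  by scaling the \<open>[\<p>, \<p>]\<close> part of the bracket by \<open>\<epsilon> \<in> {0, 1}\<close> and using the pencil
  \<open>L\<^sub>\<p> - \<lambda> L\<^sub>\<k> + (\<lambda>\<^sup>2 - \<epsilon>) A\<close>.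
\<close>

lemma lie_algebra_anti:
  assumes "lie_algebra br"
  shows "br X Y = - br Y X"
proof -
  have bil: "bilinear br" and alt: "\<And>X. br X X = 0"
    using assms unfolding lie_algebra_def by auto
  have "br X X + br X Y + (br Y X + br Y Y) = 0"
    using alt[of "X + Y"] by (simp only: bilinear_ladd[OF bil] bilinear_radd[OF bil] ac_simps)
  then show ?thesis
    by (simp add: alt eq_neg_iff_add_eq_0)
qed

section \<open>Characteristic polynomials of representations\<close>

text \<open>Jacobi's formula, the trace of adj(P) Q, in Leibniz form: in each permutation product
  one factor at a time is replaced by its increment. Only scalar entries occur, so no topology on
  matrices enters.\<close>

definition det_deriv :: "nat \<Rightarrow> complex mat \<Rightarrow> complex mat \<Rightarrow> complex" where
  "det_deriv n P Q = (\<Sum>p | p permutes {0..<n}. signof p *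
     (\<Sum>i\<in>{0..<n}. Q $$ (i, p i) * (\<Prod>j\<in>{0..<n} - {i}. P $$ (j, p j))))"

lemma det_deriv_minus:
  assumes "Q \<in> carrier_mat n n" "R \<in> carrier_mat n n"
  shows "det_deriv n P (Q - R) = det_deriv n P Q - det_deriv n P R"
proof -
  have "(Q - R) $$ (i, p i) = Q $$ (i, p i) - R $$ (i, p i)"
    if "p permutes {0..<n}" "i \<in> {0..<n}" for p i
    using assms that permutes_in_image[OF that(1), of i] by simp
  then show ?thesis
    unfolding det_deriv_def sum_subtractf[symmetric] right_diff_distrib[symmetric]
    by (intro sum.cong refl arg_cong2[of _ _ _ _ "(*)"]) (simp add: left_diff_distrib)
qed

lemma det_has_derivative:
  fixes x :: "'a::real_normed_vector"
  assumes carrier: "\<And>y. P y \<in> carrier_mat n n"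
    and P': "\<And>i j. i < n \<Longrightarrow> j < n \<Longrightarrow>
      ((\<lambda>y. P y $$ (i, j)) has_derivative (\<lambda>h. P' h $$ (i, j))) (at x)"
  shows "((\<lambda>y. det (P y)) has_derivative (\<lambda>h. det_deriv n (P x) (P' h))) (at x)"
  unfolding det_def'[OF carrier] det_deriv_def
proof (intro has_derivative_sum has_derivative_mult_right)
  fix p assume "p \<in> {p. p permutes {0..<n}}"
  then have p: "p permutes {0..<n}" by simp
  show "((\<lambda>y. \<Prod>i = 0..<n. P y $$ (i, p i)) has_derivative
     (\<lambda>h. \<Sum>i = 0..<n. P' h $$ (i, p i) * (\<Prod>j\<in>{0..<n} - {i}. P x $$ (j, p j)))) (at x)"
    by (rule has_derivative_prod) (use permutes_in_image[OF p] in \<open>auto intro!: P'\<close>)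
qed

text \<open>Both \<open>P (1 + t B)\<close> and \<open>(1 + t B) P\<close> have determinant \<open>det P * det (1 + t B)\<close>.\<close>

lemma det_deriv_commutator:
  assumes P: "P \<in> carrier_mat n n" and B: "B \<in> carrier_mat n n"
  shows "det_deriv n P (P * B - B * P) = 0"
proof -
  have der: "((\<lambda>t::real. det (P + complex_of_real t \<cdot>\<^sub>m Q)) has_derivative
      (\<lambda>h. det_deriv n P (complex_of_real h \<cdot>\<^sub>m Q))) (at 0)" if Q: "Q \<in> carrier_mat n n" for Q
  proof -
    have eq: "P + complex_of_real 0 \<cdot>\<^sub>m Q = P"
      using P Q by auto
    have "((\<lambda>t. det (P + complex_of_real t \<cdot>\<^sub>m Q)) has_derivative
        (\<lambda>h. det_deriv n (P + complex_of_real 0 \<cdot>\<^sub>m Q) (complex_of_real h \<cdot>\<^sub>m Q))) (at 0)"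
    proof (rule det_has_derivative)
      show "P + complex_of_real t \<cdot>\<^sub>m Q \<in> carrier_mat n n" for t
        using P Q by simp
      fix i j assume ij: "i < n" "j < n"
      have "((\<lambda>t. P $$ (i, j) + complex_of_real t * Q $$ (i, j)) has_derivative
          (\<lambda>h. complex_of_real h * Q $$ (i, j))) (at 0)"
        by (auto intro!: derivative_eq_intros)
      then show "((\<lambda>t. (P + complex_of_real t \<cdot>\<^sub>m Q) $$ (i, j)) has_derivative
          (\<lambda>h. (complex_of_real h \<cdot>\<^sub>m Q) $$ (i, j))) (at 0)"
        using P Q ij by simp
    qed
    then show ?thesis unfolding eq .
  qed
  have "det (P + complex_of_real t \<cdot>\<^sub>m (P * B)) = det (P + complex_of_real t \<cdot>\<^sub>m (B * P))" for t
  proof -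
    let ?C = "1\<^sub>m n + complex_of_real t \<cdot>\<^sub>m B"
    have C: "?C \<in> carrier_mat n n" using B by simp
    have "P + complex_of_real t \<cdot>\<^sub>m (P * B) = P * ?C"
      using P B by (simp add: mult_add_distrib_mat[of _ n n _ n] mult_smult_distrib[of _ n n _ n])
    moreover have "P + complex_of_real t \<cdot>\<^sub>m (B * P) = ?C * P"
      using P B by (simp add: add_mult_distrib_mat[of _ n n _ _ n] mult_smult_assoc_mat[of _ n n _ n])
    ultimately show ?thesis
      using det_mult[OF P C] det_mult[OF C P] by simp
  qed
  then have "(\<lambda>h. det_deriv n P (complex_of_real h \<cdot>\<^sub>m (P * B))) =
      (\<lambda>h. det_deriv n P (complex_of_real h \<cdot>\<^sub>m (B * P)))"
    using der[of "P * B"] der[of "B * P"] P B by (auto intro: has_derivative_unique)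
  from fun_cong[OF this, of 1]
  have "det_deriv n P (1 \<cdot>\<^sub>m (P * B)) = det_deriv n P (1 \<cdot>\<^sub>m (B * P))" by simp
  moreover have "1 \<cdot>\<^sub>m (P * B) = P * B" "1 \<cdot>\<^sub>m (B * P) = B * P"
    by (auto intro!: eq_matI)
  ultimately have "det_deriv n P (P * B) = det_deriv n P (B * P)"
    by simp
  then show ?thesis
    using det_deriv_minus[of "P * B" n "B * P" P] P B by simp
qed

text \<open>Evaluation at \<open>z\<close> is a ring homomorphism and passes through the Leibniz
  expansion. The determinant over polynomials thereby becomes a scalar one, which can be
  differentiated in the matrix.\<close>

lemma poly_char_poly_eq_det:
  fixes M :: "complex mat"
  assumes M: "M \<in> carrier_mat n n"
  shows "poly (char_poly M) z = det (z \<cdot>\<^sub>m 1\<^sub>m n - M)"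
proof -
  have "(z \<cdot>\<^sub>m 1\<^sub>m n - M) \<in> carrier_mat n n" using M by (rule minus_carrier_mat)
  moreover have "poly (char_poly_matrix M $$ (i, p i)) z = (z \<cdot>\<^sub>m 1\<^sub>m n - M) $$ (i, p i)"
    if "p permutes {0..<n}" "i \<in> {0..<n}" for p i
    using that M permutes_in_image[OF that(1), of i] by (auto simp: char_poly_matrix_def)
  moreover have "poly (signof p :: complex poly) z = signof p" for p
    by (simp add: sign_def)
  ultimately show ?thesis
    unfolding char_poly_def det_def'[OF char_poly_matrix_closed[OF M]]
    by (subst det_def') (auto simp: poly_sum poly_prod intro!: sum.cong prod.cong)
qed

section \<open>Continuously differentiable functions\<close>

text \<open>Continuity of the derivative is asked for one direction at a time, which on a
  finite-dimensional space is the usual notion. The limit to parameters with equal squares relies on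
  it.\<close>

definition C1 :: "('a::real_normed_vector \<Rightarrow> 'b::real_normed_vector) \<Rightarrow> bool" where
  "C1 f \<longleftrightarrow> (\<exists>f'. (\<forall>x. (f has_derivative f' x) (at x)) \<and> (\<forall>v. continuous_on UNIV (\<lambda>x. f' x v)))"

lemma C1_frechet:
  assumes "C1 f"
  shows "(f has_derivative frechet_derivative f (at x)) (at x)"
    and "continuous_on UNIV (\<lambda>x. frechet_derivative f (at x) v)"
proof -
  obtain f' where f': "\<And>x. (f has_derivative f' x) (at x)" "\<And>v. continuous_on UNIV (\<lambda>x. f' x v)"
    using assms unfolding C1_def by blast
  have "f' = (\<lambda>x. frechet_derivative f (at x))"
    using frechet_derivative_at[OF f'(1)] by auto
  with f' show "(f has_derivative frechet_derivative f (at x)) (at x)"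
    and "continuous_on UNIV (\<lambda>x. frechet_derivative f (at x) v)"
    by auto
qed

lemma C1_const: "C1 (\<lambda>x. c)"
  unfolding C1_def by (rule exI[of _ "\<lambda>x h. 0"]) auto

lemma C1_bounded_linear: "bounded_linear f \<Longrightarrow> C1 f"
  unfolding C1_def by (rule exI[of _ "\<lambda>x. f"]) (auto intro: bounded_linear_imp_has_derivative)

lemma C1_bounded_linear_compose:
  assumes "bounded_linear l" "C1 f"
  shows "C1 (\<lambda>x. l (f x))"
proof -
  obtain f' where f': "\<And>x. (f has_derivative f' x) (at x)" "\<And>v. continuous_on UNIV (\<lambda>x. f' x v)"
    using assms unfolding C1_def by blast
  show ?thesis
    unfolding C1_def
    by (rule exI[of _ "\<lambda>x h. l (f' x h)"])
      (auto intro!: bounded_linear.has_derivative[OF assms(1)] f' bounded_linear.continuous_on[OF assms(1)])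
qed

lemma C1_add:
  assumes "C1 f" "C1 g"
  shows "C1 (\<lambda>x. f x + g x)"
  unfolding C1_def
  by (rule exI[of _ "\<lambda>x h. frechet_derivative f (at x) h + frechet_derivative g (at x) h"])
    (auto intro!: has_derivative_add continuous_on_add C1_frechet assms)

lemma C1_mult:
  fixes f g :: "'a::real_normed_vector \<Rightarrow> 'b::real_normed_algebra"
  assumes "C1 f" "C1 g"
  shows "C1 (\<lambda>x. f x * g x)"
  unfolding C1_def
proof (intro exI conjI allI)
  fix x
  show "((\<lambda>x. f x * g x) has_derivative
      (\<lambda>h. f x * frechet_derivative g (at x) h + frechet_derivative f (at x) h * g x)) (at x)"
    by (intro has_derivative_mult C1_frechet assms)
  have "continuous_on UNIV f" "continuous_on UNIV g"
    using assms by (auto simp: continuous_on_eq_continuous_at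
        intro!: has_derivative_continuous C1_frechet)
  then show "continuous_on UNIV (\<lambda>x. f x * frechet_derivative g (at x) v + frechet_derivative f (at x) v * g x)"
    for v
    by (intro continuous_intros C1_frechet assms)
qed

lemma C1_sum: "(\<And>i. i \<in> I \<Longrightarrow> C1 (f i)) \<Longrightarrow> C1 (\<lambda>x. \<Sum>i\<in>I. f i x)"
  by (induction I rule: infinite_finite_induct) (auto intro: C1_const C1_add)

text \<open>Polynomials depending on \<open>x\<close> are followed coefficient by coefficient, so
  that closure under sums and products reaches the coefficients of a determinant.\<close>

lemma C1_coeff_sum:
  "(\<And>i k. i \<in> I \<Longrightarrow> C1 (\<lambda>x. coeff (f i x) k)) \<Longrightarrow> C1 (\<lambda>x. coeff (\<Sum>i\<in>I. f i x) k)"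
  by (auto simp: coeff_sum intro!: C1_sum)

lemma C1_coeff_mult:
  fixes f g :: "'a::real_normed_vector \<Rightarrow> 'b::real_normed_field poly"
  assumes "\<And>k. C1 (\<lambda>x. coeff (f x) k)" "\<And>k. C1 (\<lambda>x. coeff (g x) k)"
  shows "C1 (\<lambda>x. coeff (f x * g x) k)"
  by (auto simp: coeff_mult intro!: C1_sum C1_mult assms)

lemma C1_coeff_prod:
  fixes f :: "'i \<Rightarrow> 'a::real_normed_vector \<Rightarrow> 'b::real_normed_field poly"
  shows "(\<And>i k. i \<in> I \<Longrightarrow> C1 (\<lambda>x. coeff (f i x) k)) \<Longrightarrow> C1 (\<lambda>x. coeff (\<Prod>i\<in>I. f i x) k)"
  by (induction I arbitrary: k rule: infinite_finite_induct)
    (auto intro: C1_const C1_coeff_mult)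

section \<open>Coefficients of characteristic polynomials\<close>

text \<open>The conditions of \<open>matrix_realization\<close> short of injectivity: the
  complexified adjoint representation and the matrix realizations become instances of one
  notion.\<close>

definition lie_representation ::
    "('v::euclidean_space \<Rightarrow> 'v \<Rightarrow> 'v) \<Rightarrow> nat \<Rightarrow> ('v \<Rightarrow> complex mat) \<Rightarrow> bool" where
  "lie_representation br n \<rho> \<longleftrightarrow>
     (\<forall>X. \<rho> X \<in> carrier_mat n n) \<and>
     (\<forall>X Y. \<rho> (X + Y) = \<rho> X + \<rho> Y) \<and>
     (\<forall>a X. \<rho> (a *\<^sub>R X) = complex_of_real a \<cdot>\<^sub>m \<rho> X) \<and>
     (\<forall>X Y. \<rho> (br X Y) = \<rho> X * \<rho> Y - \<rho> Y * \<rho> X)"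

lemma lie_representation_entry_bounded_linear:
  assumes "lie_representation br n \<rho>" "i < n" "j < n"
  shows "bounded_linear (\<lambda>X. \<rho> X $$ (i, j))"
proof -
  have "\<rho> X \<in> carrier_mat n n" for X
    using assms by (simp add: lie_representation_def)
  then have "linear (\<lambda>X. \<rho> X $$ (i, j))"
    using assms carrier_matD[of "\<rho> X" n n for X]
    by (intro linearI) (simp_all add: lie_representation_def scaleR_conv_of_real)
  then show ?thesis by (simp add: linear_conv_bounded_linear)
qed

lemma C1_char_poly_coeff:
  assumes "lie_representation br n \<rho>"
  shows "C1 (\<lambda>X. coeff (char_poly (\<rho> X)) k)"
proof -
  have \<rho>: "\<rho> X \<in> carrier_mat n n" for X
    using assms by (simp add: lie_representation_def)
  have entry: "C1 (\<lambda>X. coeff (char_poly_matrix (\<rho> X) $$ (i, p i)) k)"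
    if "p permutes {0..<n}" "i \<in> {0..<n}" for p i k
  proof -
    have ij: "i < n" "p i < n" using that permutes_in_image[OF that(1), of i] by auto
    \<comment> \<open>Of an entry of the characteristic matrix, only the constant coefficient
      depends on \<open>X\<close>, and it does so affinely.\<close>
    have "coeff (char_poly_matrix (\<rho> X) $$ (i, p i)) k =
        coeff ([:0, 1:] * (1\<^sub>m n $$ (i, p i))) k + (if k = 0 then - 1 else 0) * \<rho> X $$ (i, p i)" for X
      using ij carrier_matD[OF \<rho>[of X]] by (auto simp: char_poly_matrix_def coeff_pCons split: nat.splits)
    then show ?thesis
      by (simp only:) (intro C1_add C1_const C1_mult C1_bounded_linear
          lie_representation_entry_bounded_linear[OF assms] ij)
  qed
  show ?thesis
    unfolding char_poly_def det_def'[OF char_poly_matrix_closed[OF \<rho>]]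
    by (intro C1_coeff_sum C1_coeff_mult C1_const C1_coeff_prod entry) auto
qed

text \<open>Moving \<open>X\<close> along \<open>br X Y\<close> conjugates \<open>\<rho> X\<close>
  infinitesimally. All coefficients are handled at once: their derivatives in this direction are the
  coefficients of a polynomial whose value at \<open>z\<close> is the derivative of the determinant
  of \<open>z - \<rho> X\<close>, and a polynomial with all values zero is zero.\<close>

lemma char_poly_coeff_invariant:
  assumes rep: "lie_representation br n \<rho>"
  shows "frechet_derivative (\<lambda>X. coeff (char_poly (\<rho> X)) k) (at X) (br X Y) = 0"
proof -
  define c where "c k = frechet_derivative (\<lambda>X. coeff (char_poly (\<rho> X)) k) (at X) (br X Y)" for k
  have \<rho>: "\<rho> X \<in> carrier_mat n n" for X
    using rep by (simp add: lie_representation_def)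
  have deg: "degree (char_poly (\<rho> X)) = n" for X
    using degree_monic_char_poly[OF \<rho>] by simp
  have "poly (\<Sum>k\<le>n. monom (c k) k) z = 0" for z
  proof -
    have "((\<lambda>X. \<Sum>k\<le>n. coeff (char_poly (\<rho> X)) k * z ^ k) has_derivative
        (\<lambda>h. \<Sum>k\<le>n. frechet_derivative (\<lambda>X. coeff (char_poly (\<rho> X)) k) (at X) h * z ^ k)) (at X)"
      by (intro has_derivative_sum has_derivative_mult_left C1_frechet C1_char_poly_coeff[OF rep])
    also have "(\<lambda>X. \<Sum>k\<le>n. coeff (char_poly (\<rho> X)) k * z ^ k) = (\<lambda>X. det (z \<cdot>\<^sub>m 1\<^sub>m n - \<rho> X))"
      unfolding poly_char_poly_eq_det[OF \<rho>, symmetric] poly_altdef deg ..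
    finally have 1: "((\<lambda>X. det (z \<cdot>\<^sub>m 1\<^sub>m n - \<rho> X)) has_derivative
        (\<lambda>h. \<Sum>k\<le>n. frechet_derivative (\<lambda>X. coeff (char_poly (\<rho> X)) k) (at X) h * z ^ k)) (at X)" .
    have 2: "((\<lambda>X. det (z \<cdot>\<^sub>m 1\<^sub>m n - \<rho> X)) has_derivative
        (\<lambda>h. det_deriv n (z \<cdot>\<^sub>m 1\<^sub>m n - \<rho> X) (- \<rho> h))) (at X)"
    proof (rule det_has_derivative)
      show "z \<cdot>\<^sub>m 1\<^sub>m n - \<rho> X \<in> carrier_mat n n" for X
        using \<rho>[of X] by (rule minus_carrier_mat)
      fix i j assume ij: "i < n" "j < n"
      have "((\<lambda>X. (z \<cdot>\<^sub>m 1\<^sub>m n) $$ (i, j) - \<rho> X $$ (i, j)) has_derivative (\<lambda>h. 0 - \<rho> h $$ (i, j))) (at X)"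
        by (intro has_derivative_diff has_derivative_const bounded_linear_imp_has_derivative
            lie_representation_entry_bounded_linear[OF rep] ij)
      then show "((\<lambda>X. (z \<cdot>\<^sub>m 1\<^sub>m n - \<rho> X) $$ (i, j)) has_derivative (\<lambda>h. (- \<rho> h) $$ (i, j))) (at X)"
        using ij carrier_matD[OF \<rho>] by simp
    qed
    let ?P = "z \<cdot>\<^sub>m 1\<^sub>m n - \<rho> X"
    have *: "?P \<in> carrier_mat n n" using \<rho>[of X] by (rule minus_carrier_mat)
    \<comment> \<open>The scalar matrix \<open>z\<close> commutes with \<open>\<rho> Y\<close>, so
      the increment is a commutator with the very matrix whose determinant is
      differentiated.\<close>
    have "- \<rho> (br X Y) = ?P * \<rho> Y - \<rho> Y * ?P"
    proof -
      have "\<rho> (br X Y) = \<rho> X * \<rho> Y - \<rho> Y * \<rho> X"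
        using rep by (simp add: lie_representation_def)
      moreover have "?P * \<rho> Y = z \<cdot>\<^sub>m \<rho> Y - \<rho> X * \<rho> Y"
        using \<rho>[of X] \<rho>[of Y]
        by (simp add: minus_mult_distrib_mat[of _ n n _ _ n] mult_smult_assoc_mat[of _ n n _ n])
      moreover have "\<rho> Y * ?P = z \<cdot>\<^sub>m \<rho> Y - \<rho> Y * \<rho> X"
        using \<rho>[of X] \<rho>[of Y]
        by (simp add: mult_minus_distrib_mat[of _ n n _ n] mult_smult_distrib[of _ n n _ n])
      ultimately show ?thesis
        using \<rho>[of X] \<rho>[of Y] by (auto intro!: eq_matI)
    qed
    then have "det_deriv n ?P (- \<rho> (br X Y)) = 0"
      using det_deriv_commutator[OF * \<rho>[of Y]] by simp
    then show ?thesis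
      using fun_cong[OF has_derivative_unique[OF 1 2], of "br X Y"]
      by (simp add: poly_sum poly_monom c_def)
  qed
  then have "(\<Sum>k\<le>n. monom (c k) k) = 0"
    using poly_all_0_iff_0 by blast
  then have "coeff (\<Sum>i\<le>n. monom (c i) i) k = 0" by simp
  then have "c k = 0" if "k \<le> n"
    using that by (simp add: coeff_sum)
  moreover have "c k = 0" if "k > n"
  proof -
    have "(\<lambda>X. coeff (char_poly (\<rho> X)) k) = (\<lambda>X. 0)"
      using deg that by (intro ext coeff_eq_0) simp
    then show ?thesis by (simp add: c_def)
  qed
  ultimately show ?thesis
    unfolding c_def by linarith
qed

section \<open>Operator matrices and the adjoint representation\<close>

text \<open>The enumeration chosen in \<open>op_matrix\<close> does not depend on the operator; one
  \<open>bs\<close> for all \<open>f\<close> is what makes matrices of composed operators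
  multiply.\<close>

lemma op_matrix_basis:
  obtains bs where "distinct bs" "set bs = (Basis :: 'v::euclidean_space set)" "length bs = DIM('v)"
    "\<And>f :: 'v \<Rightarrow> 'v. op_matrix f = mat DIM('v) DIM('v) (\<lambda>(i, j). inner (f (bs ! j)) (bs ! i))"
proof -
  define bs where "bs = (SOME bs. distinct bs \<and> set bs = (Basis :: 'v set))"
  have "\<exists>bs. distinct bs \<and> set bs = (Basis :: 'v set)"
    using finite_distinct_list[of "Basis :: 'v set"] by auto
  then have bs: "distinct bs \<and> set bs = Basis"
    unfolding bs_def by (rule someI_ex)
  then have "length bs = DIM('v)"
    using distinct_card[of bs] by simp
  then show ?thesis
    using that[of bs] bs by (simp add: op_matrix_def bs_def[symmetric])
qed

lemma op_matrix_comp: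
  fixes f g :: "'v::euclidean_space \<Rightarrow> 'v"
  assumes "linear f"
  shows "op_matrix (\<lambda>x. f (g x)) = op_matrix f * op_matrix g"
proof -
  obtain bs where bs: "distinct bs" "set bs = (Basis :: 'v set)" "length bs = DIM('v)"
    and op: "\<And>f :: 'v \<Rightarrow> 'v. op_matrix f = mat DIM('v) DIM('v) (\<lambda>(i, j). inner (f (bs ! j)) (bs ! i))"
    using op_matrix_basis by blast
  have "inner (f (g x)) y = (\<Sum>k = 0..<DIM('v). inner (f (bs ! k)) y * inner (g x) (bs ! k))" for x y
  proof -
    have "f (g x) = f (\<Sum>b\<in>Basis. inner (g x) b *\<^sub>R b)"
      by (simp add: euclidean_representation)
    also have "\<dots> = (\<Sum>b\<in>Basis. inner (g x) b *\<^sub>R f b)"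
      using assms by (simp add: linear_sum linear_cmul)
    finally have "inner (f (g x)) y = (\<Sum>b\<in>set bs. inner (f b) y * inner (g x) b)"
      by (simp add: inner_sum_left bs mult.commute)
    also have "\<dots> = (\<Sum>k = 0..<DIM('v). inner (f (bs ! k)) y * inner (g x) (bs ! k))"
      using bs by (subst sum.reindex_bij_betw[symmetric, OF bij_betw_nth[of bs "{0..<DIM('v)}"]])
        (auto simp: atLeast0LessThan)
    finally show ?thesis .
  qed
  then show ?thesis
    unfolding op by (intro eq_matI) (auto simp: scalar_prod_def)
qed

text \<open>The Jacobi identity says that \<open>br (br X Y)\<close> is the commutator of
  \<open>br X\<close> and \<open>br Y\<close>. The entries are made complex to fit
  \<open>lie_representation\<close>.\<close>

lemma adjoint_representation:
  fixes br :: "'v::euclidean_space \<Rightarrow> 'v \<Rightarrow> 'v"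
  assumes "lie_algebra br"
  shows "lie_representation br DIM('v) (\<lambda>X. map_mat complex_of_real (op_matrix (br X)))"
proof -
  have bil: "bilinear br" and alt: "\<And>X. br X X = 0"
    and jac: "\<And>X Y Z. br X (br Y Z) + br Y (br Z X) + br Z (br X Y) = 0"
    using assms unfolding lie_algebra_def by auto
  have lin: "linear (br X)" for X
    using bil by (simp add: bilinear_def)
  obtain bs where op: "\<And>f :: 'v \<Rightarrow> 'v. op_matrix f = mat DIM('v) DIM('v) (\<lambda>(i, j). inner (f (bs ! j)) (bs ! i))"
    using op_matrix_basis by blast
  have carrier: "op_matrix f \<in> carrier_mat DIM('v) DIM('v)" for f :: "'v \<Rightarrow> 'v"
    by (simp add: op)
  note anti = lie_algebra_anti[OF assms]
  have "br (br X Y) Z = br X (br Y Z) - br Y (br X Z)" for X Y Z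
    using jac[of X Y Z] anti[of Z X] anti[of "br X Y" Z]
    by (simp add: bilinear_rneg[OF bil] algebra_simps add_eq_0_iff)
  then have "op_matrix (br (br X Y)) = op_matrix (\<lambda>Z. br X (br Y Z)) - op_matrix (\<lambda>Z. br Y (br X Z))" for X Y
    unfolding op by (intro eq_matI) (auto simp: inner_diff_left)
  moreover have "op_matrix (\<lambda>Z. br X (br Y Z)) = op_matrix (br X) * op_matrix (br Y)" for X Y
    by (rule op_matrix_comp[OF lin])
  ultimately have comm: "op_matrix (br (br X Y)) =
      op_matrix (br X) * op_matrix (br Y) - op_matrix (br Y) * op_matrix (br X)" for X Y
    by (simp only:)
  have hom_diff: "map_mat complex_of_real (M - N) = map_mat complex_of_real M - map_mat complex_of_real N"
    if "M \<in> carrier_mat n n" "N \<in> carrier_mat n n" for M N n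
    using that by (intro eq_matI) auto
  have "map_mat complex_of_real (op_matrix (br (br X Y))) =
      map_mat complex_of_real (op_matrix (br X)) * map_mat complex_of_real (op_matrix (br Y)) -
      map_mat complex_of_real (op_matrix (br Y)) * map_mat complex_of_real (op_matrix (br X))" for X Y
    unfolding comm
    by (subst hom_diff[of _ "DIM('v)"])
      (auto simp: of_real_hom.mat_hom_mult[OF carrier carrier] intro!: mult_carrier_mat carrier)
  then show ?thesis
    unfolding lie_representation_def using carrier
    by (auto simp: op bilinear_ladd[OF bil] bilinear_lmul[OF bil] inner_add_left intro!: eq_matI)
qed

text \<open>Each spectral function is \<open>Re\<close> or \<open>Im\<close> of a coefficient
  belonging to a representation, the adjoint case being the real part of its complexification. Both
  properties pass through such a linear functional.\<close>

lemma spectral_functions_invariant: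
  assumes "lie_algebra br" "f \<in> spectral_functions br"
  shows "C1 f" and "frechet_derivative f (at X) (br X Y) = 0"
proof -
  have "\<exists>l n \<rho> k. bounded_linear l \<and> lie_representation br n \<rho> \<and>
      f = (\<lambda>X. l (coeff (char_poly (\<rho> X)) k))"
  proof -
    consider (ad) k where "f = (\<lambda>X. coeff (char_poly (op_matrix (br X))) k)"
      | (re) \<rho> n k where "matrix_realization br n \<rho>" "f = (\<lambda>X. Re (coeff (char_poly (\<rho> X)) k))"
      | (im) \<rho> n k where "matrix_realization br n \<rho>" "f = (\<lambda>X. Im (coeff (char_poly (\<rho> X)) k))"
      using assms(2) unfolding spectral_functions_def by blast
    then show ?thesis
    proof cases
      case ad
      have "op_matrix g \<in> carrier_mat DIM('a) DIM('a)" for g :: "'a \<Rightarrow> 'a"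
        by (simp add: op_matrix_def Let_def)
      then have "f = (\<lambda>X. Re (coeff (char_poly (map_mat complex_of_real (op_matrix (br X)))) k))"
        unfolding ad by (subst of_real_hom.char_poly_hom) auto
      then show ?thesis
        using adjoint_representation[OF assms(1)] bounded_linear_Re by blast
    next
      case re
      then show ?thesis
        using bounded_linear_Re unfolding matrix_realization_def lie_representation_def by blast
    next
      case im
      then show ?thesis
        using bounded_linear_Im unfolding matrix_realization_def lie_representation_def by blast
    qed
  qed
  then obtain l n \<rho> k where l: "bounded_linear l" and rep: "lie_representation br n \<rho>"
    and f: "f = (\<lambda>X. l (coeff (char_poly (\<rho> X)) k))" by blast
  show "C1 f"
    unfolding f by (rule C1_bounded_linear_compose[OF l C1_char_poly_coeff[OF rep]])
  have "(f has_derivative (\<lambda>h. l (frechet_derivative (\<lambda>X. coeff (char_poly (\<rho> X)) k) (at X) h))) (at X)"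
    unfolding f by (rule bounded_linear.has_derivative[OF l C1_frechet(1)[OF C1_char_poly_coeff[OF rep]]])
  then have "frechet_derivative f (at X) = (\<lambda>h. l (frechet_derivative (\<lambda>X. coeff (char_poly (\<rho> X)) k) (at X) h))"
    by (rule frechet_derivative_at[symmetric])
  then show "frechet_derivative f (at X) (br X Y) = 0"
    using char_poly_coeff_invariant[OF rep] linear_0[OF bounded_linear.linear[OF l]] by simp
qed

section \<open>The Killing form of a symmetric Lie algebra\<close>

lemma op_trace_comp_commute:
  fixes f g :: "'v::euclidean_space \<Rightarrow> 'v"
  assumes "linear f" "linear g"
  shows "op_trace (f \<circ> g) = op_trace (g \<circ> f)"
proof -
  have comp: "op_trace (f \<circ> g) = (\<Sum>b\<in>Basis. \<Sum>c\<in>Basis. inner (g b) c * inner (f c) b)"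
    if "linear f" for f g :: "'v \<Rightarrow> 'v"
  proof -
    have "inner (f (g b)) b = (\<Sum>c\<in>Basis. inner (g b) c * inner (f c) b)" for b
    proof -
      have "f (g b) = f (\<Sum>c\<in>Basis. inner (g b) c *\<^sub>R c)"
        by (simp add: euclidean_representation)
      also have "\<dots> = (\<Sum>c\<in>Basis. inner (g b) c *\<^sub>R f c)"
        using that by (simp add: linear_sum linear_cmul)
      finally show ?thesis by (simp add: inner_sum_left)
    qed
    then show ?thesis by (simp add: op_trace_def)
  qed
  show ?thesis
    unfolding comp[OF assms(1)] comp[OF assms(2)] by (subst sum.swap) (simp add: mult.commute)
qed

lemma op_trace_diff: "op_trace (\<lambda>x. f x - g x) = op_trace f - op_trace g"
  by (simp add: op_trace_def inner_diff_left sum_subtractf)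

text \<open>The Lie-algebraic content of the symmetric pair; \<open>s\<close> stands for the
  differential of the group involution.\<close>

locale symmetric_lie_algebra =
  fixes br :: "'v::euclidean_space \<Rightarrow> 'v \<Rightarrow> 'v" and s :: "'v \<Rightarrow> 'v"
    and c :: real and ip :: "'v \<Rightarrow> 'v \<Rightarrow> real"
  assumes lie: "lie_algebra br" and semi: "semisimple br"
    and linear_s: "linear s" and s_s: "s (s X) = X"
    and s_br: "s (br X Y) = br (s X) (s Y)"
    and c_nonzero: "c \<noteq> 0" and ip_def: "ip = (\<lambda>X Y. c * killing_form br X Y)"
begin

lemma bilinear_br: "bilinear br" and br_self: "br X X = 0"
  and jacobi: "br X (br Y Z) + br Y (br Z X) + br Z (br X Y) = 0"
  using lie unfolding lie_algebra_def by auto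

lemma linear_br: "linear (br X)"
  using bilinear_br by (simp add: bilinear_def)

lemmas br_anti = lie_algebra_anti[OF lie]

lemma br_br: "br (br X Y) = (\<lambda>Z. br X (br Y Z) - br Y (br X Z))"
  using jacobi[of X Y] br_anti[of _ X] br_anti[of "br X Y"]
  by (simp add: fun_eq_iff bilinear_rneg[OF bilinear_br] algebra_simps add_eq_0_iff)

lemmas br_simps =
  bilinear_ladd[OF bilinear_br] bilinear_radd[OF bilinear_br]
  bilinear_lsub[OF bilinear_br] bilinear_rsub[OF bilinear_br]
  bilinear_lmul[OF bilinear_br] bilinear_rmul[OF bilinear_br]
  bilinear_lneg[OF bilinear_br] bilinear_rneg[OF bilinear_br]
  bilinear_lzero[OF bilinear_br] bilinear_rzero[OF bilinear_br]

lemma ip_commute: "ip X Y = ip Y X"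
  by (simp add: ip_def killing_form_def op_trace_comp_commute[OF linear_br linear_br])

lemma bilinear_ip: "bilinear ip"
proof -
  have "linear (ip X)" for X
    by (rule linearI)
      (simp_all add: ip_def killing_form_def op_trace_def br_simps linear_add[OF linear_br]
        linear_cmul[OF linear_br] inner_add_left sum.distrib sum_distrib_left algebra_simps)
  moreover from this have "linear (\<lambda>X. ip X Y)" for Y
    by (subst ip_commute)
  ultimately show ?thesis by (simp add: bilinear_def)
qed

lemmas ip_simps =
  bilinear_ladd[OF bilinear_ip] bilinear_radd[OF bilinear_ip]
  bilinear_lsub[OF bilinear_ip] bilinear_rsub[OF bilinear_ip]
  bilinear_lmul[OF bilinear_ip] bilinear_rmul[OF bilinear_ip]
  bilinear_lneg[OF bilinear_ip] bilinear_rneg[OF bilinear_ip]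
  bilinear_lzero[OF bilinear_ip] bilinear_rzero[OF bilinear_ip]

text \<open>Expanding both double brackets by Jacobi leaves traces of triple compositions that agree
  up to a cyclic permutation.\<close>

lemma ip_br: "ip (br X Y) Z = ip X (br Y Z)"
proof -
  have comp: "linear (br X \<circ> br Y)" for X Y
    by (intro linear_compose linear_br)
  have "op_trace (br (br X Y) \<circ> br Z) =
      op_trace (br X \<circ> br Y \<circ> br Z) - op_trace (br Y \<circ> (br X \<circ> br Z))"
    by (simp add: br_br comp_def op_trace_diff)
  also have "op_trace (br Y \<circ> (br X \<circ> br Z)) = op_trace (br X \<circ> br Z \<circ> br Y)"
    by (rule op_trace_comp_commute[OF linear_br comp])
  also have "op_trace (br X \<circ> br Y \<circ> br Z) - op_trace (br X \<circ> br Z \<circ> br Y) =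
      op_trace (br X \<circ> br (br Y Z))"
    by (simp add: br_br comp_def op_trace_diff[symmetric] linear_diff[OF linear_br])
  finally show ?thesis
    by (simp add: ip_def killing_form_def comp_def)
qed

text \<open>An automorphism conjugates the operators \<open>br X\<close>, and traces are invariant
  under conjugation.\<close>

lemma ip_s: "ip (s X) (s Y) = ip X Y"
proof -
  have "br (s X) = s \<circ> br X \<circ> s" for X
    by (simp add: fun_eq_iff s_br s_s)
  then have "op_trace (br (s X) \<circ> br (s Y)) = op_trace (s \<circ> (br X \<circ> br Y \<circ> s))"
    by (simp add: comp_def s_s)
  also have "\<dots> = op_trace (br X \<circ> br Y \<circ> s \<circ> s)"
    by (intro op_trace_comp_commute linear_compose linear_s linear_br)
  also have "\<dots> = op_trace (br X \<circ> br Y)"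
    by (simp add: comp_def s_s)
  finally show ?thesis by (simp add: ip_def killing_form_def)
qed

lemma ip_nondegenerate:
  assumes "\<And>Y. ip X Y = 0"
  shows "X = 0"
  using semi assms c_nonzero unfolding semisimple_def ip_def by auto

text \<open>\<open>R\<close> expresses the form through the Euclidean inner product. Nondegeneracy
  makes it injective, hence surjective by dimension. This gives meaning to the \<open>THE\<close> in
  \<open>differential\<close>.\<close>

lemma ip_representing_vector:
  assumes "linear \<phi>"
  shows "\<exists>!X. \<forall>Y. ip X Y = \<phi> Y"
proof (rule ex_ex1I)
  define R where "R X = (\<Sum>b\<in>Basis. ip X b *\<^sub>R b)" for X
  have expand: "\<psi> Y = (\<Sum>b\<in>Basis. inner Y b * \<psi> b)" if "linear \<psi>" for \<psi> :: "'v \<Rightarrow> real" and Y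
  proof -
    have "\<psi> Y = \<psi> (\<Sum>b\<in>Basis. inner Y b *\<^sub>R b)"
      by (simp add: euclidean_representation)
    then show ?thesis
      using that by (simp add: linear_sum linear_cmul)
  qed
  have lin_ip: "linear (ip X)" for X
    using bilinear_ip by (simp add: bilinear_def)
  have R_inner: "inner Y (R X) = ip X Y" for X Y
    using expand[OF lin_ip, of X Y] by (simp add: R_def inner_sum_right mult.commute)
  have "linear R"
    unfolding R_def by (rule linearI)
      (simp_all add: ip_simps scaleR_add_left sum.distrib scaleR_sum_right)
  moreover have "inj R"
  proof (subst linear_injective_0[OF \<open>linear R\<close>], intro allI impI)
    fix X assume "R X = 0"
    then show "X = 0"
      using R_inner[of _ X] by (intro ip_nondegenerate) simp
  qed
  ultimately have "surj R"
    by (rule linear_inj_imp_surj)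
  then obtain X where "R X = (\<Sum>b\<in>Basis. \<phi> b *\<^sub>R b)"
    by (metis surjD)
  then have "ip X Y = \<phi> Y" for Y
    using R_inner[of Y X] expand[OF assms, of Y] by (simp add: inner_sum_right mult.commute)
  then show "\<exists>X. \<forall>Y. ip X Y = \<phi> Y" by blast
next
  fix X X'
  assume "\<forall>Y. ip X Y = \<phi> Y" "\<forall>Y. ip X' Y = \<phi> Y"
  then show "X = X'"
    using ip_nondegenerate[of "X - X'"] by (simp add: ip_simps)
qed

section \<open>Eigenspace components and the scaled bracket\<close>

abbreviation "\<p> \<equiv> part_p s"
abbreviation "\<k> \<equiv> part_k s"

lemma parts_add: "\<p> X + \<k> X = X"
  by (simp add: part_p_def part_k_def flip: scaleR_add_right)

lemma s_part_p: "s (\<p> X) = - \<p> X" and s_part_k: "s (\<k> X) = \<k> X"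
  by (simp_all add: part_p_def part_k_def linear_cmul[OF linear_s] linear_diff[OF linear_s]
      linear_add[OF linear_s] s_s add.commute flip: scaleR_minus_right)

lemma linear_part_p: "linear \<p>" and linear_part_k: "linear \<k>"
  unfolding part_p_def part_k_def
  by (auto intro!: linear_compose_scale_right linear_compose_sub linear_compose_add linear_ident linear_s)

lemma part_p_eq: "s X = - X \<Longrightarrow> \<p> X = X" "s X = X \<Longrightarrow> \<p> X = 0"
  and part_k_eq: "s X = - X \<Longrightarrow> \<k> X = 0" "s X = X \<Longrightarrow> \<k> X = X"
  by (simp_all add: part_p_def part_k_def scaleR_2[symmetric])

lemma triple_s: "ip (s X) (br (s Y) (s Z)) = ip X (br Y Z)"
  by (simp add: ip_s flip: s_br)

text \<open>\<open>s\<close> preserves triple products and contributes a factor \<open>- 1\<close>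
  for each \<open>\<p>\<close> component, so those with an odd number of them vanish.\<close>

lemma triple_parity:
  "ip (\<p> X) (br (\<p> Y) (\<p> Z)) = 0" "ip (\<p> X) (br (\<k> Y) (\<k> Z)) = 0"
  "ip (\<k> X) (br (\<p> Y) (\<k> Z)) = 0" "ip (\<k> X) (br (\<k> Y) (\<p> Z)) = 0"
  using triple_s[of "\<p> X" "\<p> Y" "\<p> Z"] triple_s[of "\<p> X" "\<k> Y" "\<k> Z"]
    triple_s[of "\<k> X" "\<p> Y" "\<k> Z"] triple_s[of "\<k> X" "\<k> Y" "\<p> Z"]
  by (simp_all add: s_part_p s_part_k br_simps ip_simps)

text \<open>The semisimple bracket for \<open>\<epsilon> = 1\<close>, the semidirect bracket for \<open>\<epsilon> = 0\<close>.\<close>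

definition scaled_bracket :: "real \<Rightarrow> 'v \<Rightarrow> 'v \<Rightarrow> 'v" where
  "scaled_bracket \<epsilon> X Y =
     \<epsilon> *\<^sub>R br (\<p> X) (\<p> Y) + br (\<k> X) (\<p> Y) + br (\<p> X) (\<k> Y) + br (\<k> X) (\<k> Y)"

lemma scaled_bracket_1: "scaled_bracket 1 = br"
proof (intro ext)
  fix X Y
  have "br X Y = br (\<p> X + \<k> X) (\<p> Y + \<k> Y)"
    by (simp only: parts_add)
  then show "scaled_bracket 1 X Y = br X Y"
    by (simp add: scaled_bracket_def br_simps algebra_simps)
qed

lemma scaled_bracket_0: "scaled_bracket 0 = semidirect_bracket br s"
  by (simp add: fun_eq_iff scaled_bracket_def semidirect_bracket_def br_anti[of "\<k> _" "\<p> _"])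

abbreviation twist :: "real \<Rightarrow> 'v \<Rightarrow> 'v" where
  "twist t X \<equiv> \<p> X - t *\<^sub>R \<k> X"

lemma twist_parts: "\<p> (twist t X) = \<p> X" "\<k> (twist t X) = - t *\<^sub>R \<k> X"
  by (simp_all add: linear_diff[OF linear_part_p] linear_cmul[OF linear_part_p]
      linear_diff[OF linear_part_k] linear_cmul[OF linear_part_k] part_p_eq part_k_eq s_part_p s_part_k)

text \<open>The eigenspaces are orthogonal because \<open>s\<close> preserves the form, and
  \<open>twist t\<close> acts on each of them as a scalar.\<close>

lemma ip_twist: "ip (twist t X) Y = ip X (twist t Y)"
proof -
  have orth: "ip (\<p> X) (\<k> Y) = 0" for X Y
    using ip_s[of "\<p> X" "\<k> Y"] by (simp add: s_part_p s_part_k ip_simps)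
  have orth': "ip (\<k> X) (\<p> Y) = 0" for X Y
    using orth[of Y X] ip_commute by simp
  have "ip (twist t X) (\<p> Y + \<k> Y) = ip (\<p> X + \<k> X) (twist t Y)"
    by (simp add: ip_simps orth orth')
  then show ?thesis by (simp only: parts_add)
qed

text \<open>
  Pairing \<open>[M, X] = 0\<close> and \<open>[N, Y] = 0\<close> with the components of \<open>Y\<close> and \<open>X\<close> gives four linear
  relations between the triple products of the components of \<open>L\<close>, \<open>A\<close>, \<open>X\<close>, \<open>Y\<close>; eliminating the
  two that involve \<open>A\<close> leaves \<open>t\<^sup>2 - u\<^sup>2\<close> times the claim.
\<close>

lemma involution_identity:
  assumes A: "s A = - A" and tu: "t\<^sup>2 \<noteq> u\<^sup>2"
    and X: "br (twist t L + (t\<^sup>2 - \<epsilon>) *\<^sub>R A) X = 0"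
    and Y: "br (twist u L + (u\<^sup>2 - \<epsilon>) *\<^sub>R A) Y = 0"
  shows "ip L (scaled_bracket \<epsilon> (twist t X) (twist u Y)) = 0"
proof -
  have pA: "\<p> A = A" using A by (rule part_p_eq)
  have parityA: "ip A (br (\<p> Y) (\<p> Z)) = 0" "ip A (br (\<k> Y) (\<k> Z)) = 0" for Y Z
    using triple_parity(1,2)[of A] by (simp_all add: pA)
  note parity = triple_parity parityA
  \<comment> \<open>By parity, these six are the only products of a component of \<open>L\<close> or
    \<open>A\<close> with components of \<open>X\<close> and \<open>Y\<close> that can be
    nonzero.\<close>
  define a where "a = ip (\<p> L) (br (\<p> X) (\<k> Y))"
  define b where "b = ip (\<p> L) (br (\<k> X) (\<p> Y))"
  define d where "d = ip A (br (\<p> X) (\<k> Y))"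
  define f where "f = ip A (br (\<k> X) (\<p> Y))"
  define e where "e = ip (\<k> L) (br (\<k> X) (\<k> Y))"
  define g where "g = ip (\<k> L) (br (\<p> X) (\<p> Y))"
  have pairX: "ip (twist t L + (t\<^sup>2 - \<epsilon>) *\<^sub>R A) (br (\<p> X + \<k> X) Z) = 0" for Z
    using X by (simp only: parts_add flip: ip_br) (simp add: ip_simps)
  have pairY: "ip (twist u L + (u\<^sup>2 - \<epsilon>) *\<^sub>R A) (br Z (\<p> Y + \<k> Y)) = 0" for Z
    using Y by (simp only: parts_add br_anti[of Z Y] ip_simps flip: ip_br)
  have 1: "a + (t\<^sup>2 - \<epsilon>) * d = t * e"
    using pairX[of "\<k> Y"] by (simp add: ip_simps br_simps parity a_def d_def e_def)
  have 2: "b + (t\<^sup>2 - \<epsilon>) * f = t * g"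
    using pairX[of "\<p> Y"] by (simp add: ip_simps br_simps parity b_def f_def g_def)
  have 3: "b + (u\<^sup>2 - \<epsilon>) * f = u * e"
    using pairY[of "\<k> X"] by (simp add: ip_simps br_simps parity b_def f_def e_def)
  have 4: "a + (u\<^sup>2 - \<epsilon>) * d = u * g"
    using pairY[of "\<p> X"] by (simp add: ip_simps br_simps parity a_def d_def g_def)
  \<comment> \<open>The weights cancel the terms in \<open>d\<close>; the coefficient left at
    \<open>a\<close> is the difference of the weights, from which \<open>\<epsilon>\<close> drops
    out.\<close>
  have "(t\<^sup>2 - u\<^sup>2) * a = (t\<^sup>2 - \<epsilon>) * (a + (u\<^sup>2 - \<epsilon>) * d) - (u\<^sup>2 - \<epsilon>) * (a + (t\<^sup>2 - \<epsilon>) * d)"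
    by (simp add: algebra_simps)
  then have a: "(t\<^sup>2 - u\<^sup>2) * a = (t\<^sup>2 - \<epsilon>) * (u * g) - (u\<^sup>2 - \<epsilon>) * (t * e)"
    unfolding 1 4 .
  have "(t\<^sup>2 - u\<^sup>2) * b = (t\<^sup>2 - \<epsilon>) * (b + (u\<^sup>2 - \<epsilon>) * f) - (u\<^sup>2 - \<epsilon>) * (b + (t\<^sup>2 - \<epsilon>) * f)"
    by (simp add: algebra_simps)
  then have b: "(t\<^sup>2 - u\<^sup>2) * b = (t\<^sup>2 - \<epsilon>) * (u * e) - (u\<^sup>2 - \<epsilon>) * (t * g)"
    unfolding 2 3 .
  have "(t\<^sup>2 - u\<^sup>2) * (\<epsilon> * g - t * b - u * a + t * u * e) =
      (t\<^sup>2 - u\<^sup>2) * (\<epsilon> * g + t * u * e) - t * ((t\<^sup>2 - u\<^sup>2) * b) - u * ((t\<^sup>2 - u\<^sup>2) * a)"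
    by (simp add: algebra_simps)
  \<comment> \<open>The terms \<open>t^2 u^2 g\<close> cancel and
    \<open>\<epsilon> (t^2 - u^2) g\<close> remains: the shift of the pencil by
    \<open>\<epsilon>\<close> matches the factor \<open>\<epsilon>\<close> on the bracket of
    \<open>\<p>\<close> components.\<close>
  also have "\<dots> = 0"
    unfolding a b by (simp add: algebra_simps power2_eq_square)
  finally have "(t\<^sup>2 - u\<^sup>2) * (\<epsilon> * g - t * b - u * a + t * u * e) = 0" .
  then have "\<epsilon> * g - t * b - u * a + t * u * e = 0"
    using tu by simp
  moreover have "ip (\<p> L + \<k> L) (scaled_bracket \<epsilon> (twist t X) (twist u Y)) =
      \<epsilon> * g - t * b - u * a + t * u * e"
    by (simp add: scaled_bracket_def twist_parts ip_simps br_simps parity a_def b_def e_def g_def)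
  ultimately show ?thesis by (simp only: parts_add)
qed

section \<open>Gradients along the pencil and their Poisson brackets\<close>

lemma ip_differential:
  assumes "(f has_derivative f') (at L)"
  shows "ip (differential ip f L) Y = f' Y"
proof -
  have "linear f'" using assms by (rule has_derivative_linear)
  moreover have "frechet_derivative f (at L) = f'"
    using frechet_derivative_at[OF assms] by simp
  ultimately show ?thesis
    using theI'[OF ip_representing_vector, of f'] by (simp add: differential_def)
qed

lemma differential_eqI:
  assumes "(f has_derivative f') (at L)" "\<And>Y. ip X Y = f' Y"
  shows "differential ip f L = X"
  using ip_nondegenerate[of "differential ip f L - X"]
  by (simp add: ip_simps ip_differential[OF assms(1)] assms(2))

abbreviation pencil :: "real \<Rightarrow> 'v \<Rightarrow> real \<Rightarrow> 'v \<Rightarrow> 'v" where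
  "pencil \<epsilon> A t L \<equiv> twist t L + (t\<^sup>2 - \<epsilon>) *\<^sub>R A"

lemma linear_twist: "linear (twist t)"
  by (intro linear_compose_sub linear_compose_scale_right linear_part_p linear_part_k)

lemma has_derivative_pencil:
  assumes "(F has_derivative F') (at (pencil \<epsilon> A t L))"
  shows "((\<lambda>L. F (pencil \<epsilon> A t L)) has_derivative (\<lambda>Y. F' (twist t Y))) (at L)"
proof (rule has_derivative_compose[of "pencil \<epsilon> A t" "twist t", OF _ assms])
  have "(twist t has_derivative twist t) (at L)"
    using linear_twist[of t] by (intro bounded_linear_imp_has_derivative) (simp add: linear_conv_bounded_linear)
  then show "(pencil \<epsilon> A t has_derivative twist t) (at L)"
    using has_derivative_add_const by blast
qed

text \<open>The chain rule puts \<open>twist t\<close> on the argument of the derivative;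
  self-adjointness moves it onto the gradient.\<close>

lemma differential_pencil:
  assumes "C1 F"
  shows "differential ip (\<lambda>L. F (pencil \<epsilon> A t L)) L = twist t (differential ip F (pencil \<epsilon> A t L))"
  by (rule differential_eqI[OF has_derivative_pencil[OF C1_frechet(1)[OF assms]]])
    (simp add: ip_twist ip_differential[OF C1_frechet(1)[OF assms]])

text \<open>Invariance of \<open>F\<close> makes its gradient orthogonal to every
  \<open>br X Y\<close>; invariance of the form moves the bracket onto the gradient, and
  nondegeneracy concludes.\<close>

lemma br_differential_eq_0:
  assumes "C1 F" "\<And>Y. frechet_derivative F (at X) (br X Y) = 0"
  shows "br X (differential ip F X) = 0"
proof (rule ip_nondegenerate)
  fix Y
  have "ip (br X (differential ip F X)) Y = - ip (br (differential ip F X) X) Y"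
    by (subst br_anti) (simp add: ip_simps)
  also have "\<dots> = - ip (differential ip F X) (br X Y)"
    by (simp add: ip_br)
  also have "\<dots> = 0"
    using assms by (simp add: ip_differential[OF C1_frechet(1)[OF assms(1)]])
  finally show "ip (br X (differential ip F X)) Y = 0" .
qed

lemma linear_scaled_bracket: "linear (scaled_bracket \<epsilon> X)"
  unfolding scaled_bracket_def
  by (rule linearI) (simp_all add: linear_add[OF linear_part_p] linear_add[OF linear_part_k]
      linear_cmul[OF linear_part_p] linear_cmul[OF linear_part_k] br_simps algebra_simps)

text \<open>For \<open>t\<^sup>2 = u\<^sup>2\<close> the identity follows by continuity in the second parameter.\<close>

lemma poisson_pencil_eq_0:
  assumes A: "s A = - A" and "C1 F" "C1 H"
    and F: "\<And>X Y. frechet_derivative F (at X) (br X Y) = 0"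
    and H: "\<And>X Y. frechet_derivative H (at X) (br X Y) = 0"
  shows "poisson ip (scaled_bracket \<epsilon>) (\<lambda>L. F (pencil \<epsilon> A t L)) (\<lambda>L. H (pencil \<epsilon> A u L)) L = 0"
proof -
  define X where "X = differential ip (\<lambda>L. F (pencil \<epsilon> A t L)) L"
  define \<Phi> where "\<Phi> u = poisson ip (scaled_bracket \<epsilon>) (\<lambda>L. F (pencil \<epsilon> A t L)) (\<lambda>L. H (pencil \<epsilon> A u L)) L" for u
  have zero: "\<Phi> u = 0" if "t\<^sup>2 \<noteq> u\<^sup>2" for u
    unfolding \<Phi>_def poisson_def differential_pencil[OF \<open>C1 F\<close>] differential_pencil[OF \<open>C1 H\<close>]
    by (intro involution_identity[OF A that] br_differential_eq_0 \<open>C1 F\<close> \<open>C1 H\<close> F H)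
  have "linear (ip L)" using bilinear_ip by (simp add: bilinear_def)
  then have "linear (\<lambda>Z. ip L (scaled_bracket \<epsilon> X Z))"
    using linear_compose[OF linear_scaled_bracket] by (simp add: comp_def)
  \<comment> \<open>\<open>W\<close> turns the Poisson bracket into a derivative of the second
    function in a fixed direction. Then \<open>u\<close> enters only through the base point and the
    twist, and splitting \<open>W\<close> into components lets continuity be used one direction at a
    time.\<close>
  then obtain W where W: "\<And>Z. ip W Z = ip L (scaled_bracket \<epsilon> X Z)"
    using ip_representing_vector by blast
  define DH where "DH = (\<lambda>Y. frechet_derivative H (at Y))"
  have "\<Phi> u = DH (pencil \<epsilon> A u L) (\<p> W) - u * DH (pencil \<epsilon> A u L) (\<k> W)" for u
  proof -
    have lin: "linear (DH Y)" for Y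
      unfolding DH_def by (rule has_derivative_linear[OF C1_frechet(1)[OF \<open>C1 H\<close>]])
    have "\<Phi> u = ip W (differential ip (\<lambda>L. H (pencil \<epsilon> A u L)) L)"
      by (simp add: \<Phi>_def poisson_def X_def[symmetric] W)
    also have "\<dots> = DH (pencil \<epsilon> A u L) (twist u W)"
      unfolding DH_def
      by (subst ip_commute) (rule ip_differential[OF has_derivative_pencil[OF C1_frechet(1)[OF \<open>C1 H\<close>]]])
    finally show ?thesis
      by (simp add: linear_diff[OF lin] linear_cmul[OF lin])
  qed
  moreover have "continuous_on UNIV (\<lambda>u. DH (pencil \<epsilon> A u L) V)" for V
    unfolding DH_def
    by (rule continuous_on_compose2[OF C1_frechet(2)[OF \<open>C1 H\<close>]]) (auto intro!: continuous_intros)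
  ultimately have "continuous_on UNIV \<Phi>"
    by (simp add: fun_eq_iff[THEN iffD2] continuous_intros)
  \<comment> \<open>By continuity the exceptional set is open, yet it lies in
    \<open>{t, - t}\<close>; a finite open set of reals is empty.\<close>
  then have "open {u. \<Phi> u \<noteq> 0}"
    by (intro open_Collect_neq) auto
  moreover have "{u. \<Phi> u \<noteq> 0} \<subseteq> {t, - t}"
    using zero power2_eq_iff[of t] by fastforce
  then have "finite {u. \<Phi> u \<noteq> 0}"
    by (rule finite_subset) simp
  ultimately have "{u. \<Phi> u \<noteq> 0} = {}"
    using finite_imp_not_open by blast
  then show ?thesis
    unfolding \<Phi>_def by blast
qed

lemma spectral_invariants_poisson_commute:
  assumes A: "s A = - A"
    and f: "f \<in> spectral_invariants br (pencil \<epsilon> A)"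
    and h: "h \<in> spectral_invariants br (pencil \<epsilon> A)"
  shows "poisson ip (scaled_bracket \<epsilon>) f h L = 0"
proof -
  obtain F t where F: "f = (\<lambda>L. F (pencil \<epsilon> A t L))" "F \<in> spectral_functions br"
    using f unfolding spectral_invariants_def by blast
  obtain H u where H: "h = (\<lambda>L. H (pencil \<epsilon> A u L))" "H \<in> spectral_functions br"
    using h unfolding spectral_invariants_def by blast
  show ?thesis
    unfolding F(1) H(1)
    by (intro poisson_pencil_eq_0 A spectral_functions_invariant[OF lie F(2)]
        spectral_functions_invariant[OF lie H(2)])
qed

end

section \<open>The involution on the Lie algebra\<close>

lemma is_chart_open_image:
  assumes "is_chart T U \<phi>" "openin T V" "V \<subseteq> U"
  shows "open (\<phi> ` V)"
proof -
  have hom: "homeomorphic_map (subtopology T U) (top_of_set (\<phi> ` U)) \<phi>" and op: "open (\<phi> ` U)"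
    using assms(1) unfolding is_chart_def by auto
  have "openin (subtopology T U) V"
    using assms(2,3) by (metis openin_subtopology_Int2 inf.absorb_iff2)
  then have "openin (top_of_set (\<phi> ` U)) (\<phi> ` V)"
    using homeomorphic_imp_open_map[OF hom] unfolding open_map_def by blast
  then show ?thesis
    using op openin_open_trans by blast
qed

lemma is_chart_inv_into:
  assumes "is_chart T U \<phi>" "x \<in> U"
  shows "inv_into U \<phi> (\<phi> x) = x"
proof -
  have hom: "homeomorphic_map (subtopology T U) (top_of_set (\<phi> ` U)) \<phi>" and "U \<subseteq> topspace T"
    using assms(1) unfolding is_chart_def by (auto dest: openin_subset)
  then have "inj_on \<phi> U"
    using homeomorphic_imp_injective_map[OF hom] by (simp add: Int_absorb1)
  then show ?thesis
    using assms(2) by simp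
qed

text \<open>The chain rule is applied at the identity to the relation that \<open>\<sigma>\<close>
  composed with itself is the identity map, read in the chart.\<close>

lemma tangent_map_involution:
  fixes G :: "('g, 'r) monoid_scheme" (structure) and \<A> :: "('g, 'v::euclidean_space) chart set"
  assumes lie: "lie_group G T \<A>" and chart: "(U, \<phi>) \<in> \<A>" and one: "\<one> \<in> U"
    and inv: "involutive_automorphism G T \<A> \<sigma>"
  shows "linear (tangent_map G U \<phi> \<sigma>)"
    and "tangent_map G U \<phi> \<sigma> (tangent_map G U \<phi> \<sigma> X) = X"
proof -
  have group: "group G" and top: "topspace T = carrier G" and "smooth_manifold T \<A>"
    using lie unfolding lie_group_def by auto
  then have ch: "is_chart T U \<phi>"
    using chart unfolding smooth_manifold_def by auto
  then have opU: "openin T U" by (simp add: is_chart_def)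
  have UG: "U \<subseteq> carrier G" using openin_subset[OF opU] top by simp
  have iso: "\<sigma> \<in> iso G G" and smooth: "smooth_map T \<A> T \<A> \<sigma>"
    and inv\<sigma>: "\<And>x. x \<in> carrier G \<Longrightarrow> \<sigma> (\<sigma> x) = x"
    using inv unfolding involutive_automorphism_def by auto
  have "\<sigma> \<in> hom G G" using iso by (simp add: iso_def)
  then have \<sigma>1: "\<sigma> \<one> = \<one>"
    using hom_one group by blast
  \<comment> \<open>On the part of the chart domain that \<open>\<sigma>\<close> keeps inside
    \<open>U\<close>, \<open>g\<close> is the coordinate form of \<open>\<sigma>\<close> and
    \<open>g \<circ> g\<close> is the identity. This part is open and contains the group
    identity.\<close>
  define V where "V = {x \<in> U. \<sigma> x \<in> U}"
  define g where "g = \<phi> \<circ> \<sigma> \<circ> inv_into U \<phi>"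
  have "continuous_map T T \<sigma>" and sm: "smooth_on (\<phi> ` V) g"
    using smooth chart unfolding smooth_map_def V_def g_def by auto
  then have "openin T {x \<in> topspace T. \<sigma> x \<in> U}"
    using openin_continuous_map_preimage[OF _ opU] by blast
  moreover have "V = U \<inter> {x \<in> topspace T. \<sigma> x \<in> U}"
    using UG top by (auto simp: V_def)
  ultimately have "openin T V" using opU by auto
  then have opV: "open (\<phi> ` V)"
    by (rule is_chart_open_image[OF ch]) (auto simp: V_def)
  have 1: "\<phi> \<one> \<in> \<phi> ` V" using one \<sigma>1 by (auto simp: V_def)
  have "Ck_on (Suc 0) (\<phi> ` V) g" using sm unfolding smooth_on_def by blast
  then have "g differentiable (at (\<phi> \<one>))" using 1 by auto
  then have D: "(g has_derivative tangent_map G U \<phi> \<sigma>) (at (\<phi> \<one>))"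
    by (simp add: tangent_map_def g_def[symmetric] frechet_derivative_works)
  then show "linear (tangent_map G U \<phi> \<sigma>)"
    by (rule has_derivative_linear)
  have g: "g (\<phi> x) = \<phi> (\<sigma> x)" if "x \<in> U" for x
    using is_chart_inv_into[OF ch that] by (simp add: g_def)
  have "(g \<circ> g has_derivative tangent_map G U \<phi> \<sigma> \<circ> tangent_map G U \<phi> \<sigma>) (at (\<phi> \<one>))"
    using D by (intro diff_chain_at) (simp_all add: g[OF one] \<sigma>1)
  moreover have "(g \<circ> g has_derivative (\<lambda>h. h)) (at (\<phi> \<one>))"
  proof (rule has_derivative_transform_within_open[OF has_derivative_ident opV 1])
    fix y assume "y \<in> \<phi> ` V"
    then show "y = (g \<circ> g) y"
      using UG by (auto simp: V_def g inv\<sigma>)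
  qed
  ultimately have "tangent_map G U \<phi> \<sigma> \<circ> tangent_map G U \<phi> \<sigma> = (\<lambda>h. h)"
    by (rule has_derivative_unique)
  then show "tangent_map G U \<phi> \<sigma> (tangent_map G U \<phi> \<sigma> X) = X"
    by (metis comp_apply)
qed

text \<open>\<open>s\<close> acts by a sign on each eigenspace, and the bracket relations say that
  these signs multiply; bilinearity extends this to all vectors.\<close>

lemma involution_br:
  assumes lie: "lie_algebra br" and lin: "linear s" and ss: "\<And>X. s (s X) = X"
    and pp: "bracket_span br (eigen_p s) (eigen_p s) \<subseteq> eigen_k s"
    and pk: "bracket_span br (eigen_p s) (eigen_k s) \<subseteq> eigen_p s"
    and kk: "bracket_span br (eigen_k s) (eigen_k s) \<subseteq> eigen_k s"
  shows "s (br X Y) = br (s X) (s Y)"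
proof -
  have bil: "bilinear br"
    using lie by (simp add: lie_algebra_def)
  note anti = lie_algebra_anti[OF lie]
  have mem: "br X Y \<in> bracket_span br S S'" if "X \<in> S" "Y \<in> S'" for X Y S S'
    unfolding bracket_span_def using that by (intro span_base) blast
  have p: "part_p s X \<in> eigen_p s" and k: "part_k s X \<in> eigen_k s" for X
    by (simp_all add: eigen_p_def eigen_k_def part_p_def part_k_def linear_cmul[OF lin]
        linear_diff[OF lin] linear_add[OF lin] ss add.commute flip: scaleR_minus_right)
  have split: "X = part_p s X + part_k s X" "s X = - part_p s X + part_k s X" for X
    by (simp_all add: part_p_def part_k_def algebra_simps flip: scaleR_add_left)
  have 1: "s (br (part_p s X) (part_p s Y)) = br (part_p s X) (part_p s Y)"
    using mem[OF p p] pp by (auto simp: eigen_k_def)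
  have 2: "s (br (part_p s X) (part_k s Y)) = - br (part_p s X) (part_k s Y)" for X Y
    using mem[OF p k] pk by (auto simp: eigen_p_def)
  have 3: "s (br (part_k s X) (part_p s Y)) = - br (part_k s X) (part_p s Y)"
    using 2[of Y X] anti[of "part_k s X" "part_p s Y"] by (simp add: linear_neg[OF lin])
  have 4: "s (br (part_k s X) (part_k s Y)) = br (part_k s X) (part_k s Y)"
    using mem[OF k k] kk by (auto simp: eigen_k_def)
  have "s (br (part_p s X + part_k s X) (part_p s Y + part_k s Y)) =
      br (- part_p s X + part_k s X) (- part_p s Y + part_k s Y)"
    by (simp add: bilinear_ladd[OF bil] bilinear_radd[OF bil] bilinear_lneg[OF bil]
        bilinear_rneg[OF bil] bilinear_lsub[OF bil] bilinear_rsub[OF bil] linear_add[OF lin] 1 2 3 4 algebra_simps)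
  then show ?thesis by (simp only: split[symmetric])
qed

theorem proposition7:
  fixes G :: "('g, 'r) monoid_scheme" (structure)
    and T :: "'g topology"
    and \<A> :: "('g, 'v::euclidean_space) chart set"
    and \<sigma> :: "'g \<Rightarrow> 'g"
    and K :: "'g set"
    and U :: "'g set" and \<phi> :: "'g \<Rightarrow> 'v"
    and br :: "'v \<Rightarrow> 'v \<Rightarrow> 'v"
    and s :: "'v \<Rightarrow> 'v"
    and c :: real
    and ip :: "'v \<Rightarrow> 'v \<Rightarrow> real"
    and A :: 'v
  assumes "lie_group G T \<A>" and "connected_space T"
    and "(U, \<phi>) \<in> \<A>" and "\<one> \<in> U"
    and "br = lie_bracket_at G U \<phi>" and "lie_algebra br" and "semisimple br"
    and "involutive_automorphism G T \<A> \<sigma>"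
    and "K = fixed_points G \<sigma>" and "compactin T K"
    and "riemannian_symmetric_pair G T U \<phi> \<sigma> K"
    and "s = tangent_map G U \<phi> \<sigma>"
    and "bracket_span br (eigen_p s) (eigen_p s) = eigen_k s"
    and "bracket_span br (eigen_p s) (eigen_k s) = eigen_p s"
    and "bracket_span br (eigen_k s) (eigen_k s) \<subseteq> eigen_k s"
    and "c \<noteq> 0" and "ip = (\<lambda>X Y. c * killing_form br X Y)"
    and "regular_element br s A"
  shows "(\<forall>f \<in> spectral_invariants br (\<lambda>t L. part_p s L - t *\<^sub>R part_k s L + (t\<^sup>2 - 1) *\<^sub>R A).
          \<forall>h \<in> spectral_invariants br (\<lambda>t L. part_p s L - t *\<^sub>R part_k s L + (t\<^sup>2 - 1) *\<^sub>R A).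
          \<forall>L. poisson ip br f h L = 0) \<and>
         (\<forall>f \<in> spectral_invariants br (\<lambda>t L. part_p s L - t *\<^sub>R part_k s L + t\<^sup>2 *\<^sub>R A).
          \<forall>h \<in> spectral_invariants br (\<lambda>t L. part_p s L - t *\<^sub>R part_k s L + t\<^sup>2 *\<^sub>R A).
          \<forall>L. poisson ip (semidirect_bracket br s) f h L = 0)"
proof -
  have lin: "linear s" and ss: "\<And>X. s (s X) = X"
    using tangent_map_involution[OF assms(1,3,4,8)] assms(12) by simp_all
  have s_br: "s (br X Y) = br (s X) (s Y)" for X Y
    by (rule involution_br[OF assms(6) lin ss]) (use assms in auto)
  interpret symmetric_lie_algebra br s c ip
    by (rule symmetric_lie_algebra.intro) fact+
  have "s A = - A"
    using assms(18) by (simp add: regular_element_def eigen_p_def)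
  note commute = spectral_invariants_poisson_commute[OF this]
  show ?thesis
    using commute[where \<epsilon> = 1] commute[where \<epsilon> = 0]
    by (simp add: scaled_bracket_1 scaled_bracket_0)
qed

end
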